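(* Let $r\ge1$, $p\ge3$ be integers, $\lambda_1,\ldots,\lambda_r>0$, and assume that $k_i=k\ge3$ for every $1\le i\le r$. For $\boldsymbol m\in\mathcal{D}_r^+$ define $$\tau(\boldsymbol m)=\frac kp\sum_{i=1}^r\lambda_im_i^k,\qquad\eta(\boldsymbol m)=\sum_{i=1}^r\lambda_i^{-\frac{2}{k-2}}\mathbf 1_{\{m_i\ne0\}},$$ and let $$\tau_{\mathrm c}(p)=\frac{p-2}{\sqrt{2p(p-1)}},\qquad\eta_{\mathrm c}(p,k)=\begin{cases}(k-2)\left(\frac{2k^2}{p(k-1)^{k-1}}\right)^{\frac1{k-2}}&\text{if }k\ge p,\\(p-2)\left(\frac{2k^2}{p(p-1)^{k-1}}\right)^{\frac1{k-2}}&\text{if }k\le p.\end{cases}$$ Then $\Sigma^{\mathrm{tot}}(\boldsymbol m)\le0$ for every $\boldsymbol m\in\mathcal{D}_r^+$ with $\tau(\boldsymbol m)\ge\tau_{\mathrm c}(p)$. Moreover, for every $\boldsymbol m\in\mathcal{D}_r^+$ with $\tau(\boldsymbol m)\ge\tau_{\mathrm c}(p)$: 1. if $\eta(\boldsymbol m)>\eta_{\mathrm c}(p,k)$, then $\Sigma^{\mathrm{tot}}(\boldsymbol m)<0$; 2. if $\eta(\boldsymbol m)\le\eta_{\mathrm c}(p,k)$, then $\Sigma^{\mathrm{tot}}(\boldsymbol m)\le0$, with equality if and only if $$\lambda_im_i^{k-2}=\lambda_jm_j^{k-2}\quad\text{for all }i,j\text{ such that }m_i,m_j\ne0,\qquad\text{and}\qquad\tau(\boldsymbol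 m)=\frac1{\sqrt{2p}}\frac{\|\boldsymbol m\|_2^2}{\sqrt{1-\|\boldsymbol m\|_2^2}}.$$
   Context: $\|\cdot\|_2$ is the Euclidean norm, $\mathcal{D}_r=\{\boldsymbol{m}\in[-1,1]^r:\|\boldsymbol{m}\|_2<1\}$ and $\mathcal{D}_r^+=\mathcal{D}_r\cap[0,1]^r$. $\Omega(x)=\int\log|x-\lambda|\,\mu_{\mathrm{sc}}(d\lambda)$ with $\mu_{\mathrm{sc}}(dx)=\frac1{2\pi}\sqrt{4-x^2}\,\mathbf 1_{\{|x|\le2\}}dx$; explicitly $\Omega(x)=\frac{x^2}{4}-\frac12$ for $|x|\le2$ and $\Omega(x)=\frac{x^2}{4}-\frac12-\left[\frac{|x|}{4}\sqrt{x^2-4}-\log\frac{|x|+\sqrt{x^2-4}}{2}\right]$ for $|x|>2$. For $\boldsymbol m\in\mathcal{D}_r$ and $x\in\mathbb R$, $\Sigma^{\mathrm{tot}}(\boldsymbol{m},x)=\Sigma(\boldsymbol{m},y(\boldsymbol{m},x))$, where $y(\boldsymbol{m},x)=x-\sum_{i=1}^r\lambda_i(1-\frac{k_i}{p})m_i^{k_i}$ and $$\Sigma(\boldsymbol{m},y)=\tfrac12(\log(p-1)+1)+\tfrac12\log(1-\|\boldsymbol{m}\|_2^2)-\tfrac1p\sum_{i=1}^r\lambda_i^2k_i^2m_i^{2k_i-2}+\tfrac1p\Big(\sum_{i=1}^r\lambda_ik_im_i^{k_i}\Big)^2-\Big(y-\tfrac1p\sum_{i=1}^r\lambda_ik_im_i^{k_i}\Big)^2+\Omega\Big(\sqrt{\tfrac{2p}{p-1}}\,y\Big).$$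 Finally $\Sigma^{\mathrm{tot}}(\boldsymbol m)=\max_{x\in\mathbb R}\Sigma^{\mathrm{tot}}(\boldsymbol m,x)$. *)

theory Defs
  imports "HOL-Analysis.Analysis"
begin

text \<open>
  The number of spikes is \<open>r = CARD('r)\<close>; vectors in r-dimensional Euclidean space have type
  \<open>real ^ 'r\<close>, and \<open>norm\<close> is the Euclidean norm. Parameters: \<open>p\<close>, the family \<open>lam\<close> of signal
  strengths and the family \<open>ks\<close> of exponents.
\<close>

definition D_set :: "(real ^ 'r) set" where
  "D_set = {m. (\<forall>i. m $ i \<in> {-1..1}) \<and> norm m < 1}"

definition D_plus :: "(real ^ 'r) set" where
  "D_plus = D_set \<inter> {m. \<forall>i. m $ i \<in> {0..1}}"

definition semicircle :: "real measure" where
  "semicircle = density lborel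
     (\<lambda>x. ennreal (1 / (2 * pi) * sqrt (4 - x\<^sup>2) * indicator {x. \<bar>x\<bar> \<le> 2} x))"

text \<open>The convention \<open>ln 0 = 0\<close> only affects the null set where \<open>t = x\<close>.\<close>

definition Omega :: "real \<Rightarrow> real" where
  "Omega x = (\<integral>t. ln \<bar>x - t\<bar> \<partial>semicircle)"

definition Sigma_y :: "nat \<Rightarrow> ('r::finite \<Rightarrow> real) \<Rightarrow> ('r \<Rightarrow> nat) \<Rightarrow> real ^ 'r \<Rightarrow> real \<Rightarrow> real" where
  "Sigma_y p lam ks m y =
     1/2 * (ln (real p - 1) + 1)
     + 1/2 * ln (1 - (norm m)\<^sup>2)
     - 1 / real p * (\<Sum>i\<in>UNIV. (lam i)\<^sup>2 * (real (ks i))\<^sup>2 * (m $ i) ^ (2 * ks i - 2))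
     + 1 / real p * (\<Sum>i\<in>UNIV. lam i * real (ks i) * (m $ i) ^ ks i)\<^sup>2
     - (y - 1 / real p * (\<Sum>i\<in>UNIV. lam i * real (ks i) * (m $ i) ^ ks i))\<^sup>2
     + Omega (sqrt (2 * real p / (real p - 1)) * y)"

definition y_of :: "nat \<Rightarrow> ('r::finite \<Rightarrow> real) \<Rightarrow> ('r \<Rightarrow> nat) \<Rightarrow> real ^ 'r \<Rightarrow> real \<Rightarrow> real" where
  "y_of p lam ks m x =
     x - (\<Sum>i\<in>UNIV. lam i * (1 - real (ks i) / real p) * (m $ i) ^ ks i)"

definition Sigma_tot_x ::
  "nat \<Rightarrow> ('r::finite \<Rightarrow> real) \<Rightarrow> ('r \<Rightarrow> nat) \<Rightarrow> real ^ 'r \<Rightarrow> real \<Rightarrow> real" where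
  "Sigma_tot_x p lam ks m x = Sigma_y p lam ks m (y_of p lam ks m x)"

text \<open>
  A genuine maximum over all real \<open>x\<close>, not only a supremum: \<open>GREATEST\<close> is unspecified unless
  the value is attained.
\<close>

definition Sigma_tot :: "nat \<Rightarrow> ('r::finite \<Rightarrow> real) \<Rightarrow> ('r \<Rightarrow> nat) \<Rightarrow> real ^ 'r \<Rightarrow> real" where
  "Sigma_tot p lam ks m = (GREATEST s. s \<in> range (Sigma_tot_x p lam ks m))"

definition tau :: "nat \<Rightarrow> ('r::finite \<Rightarrow> real) \<Rightarrow> nat \<Rightarrow> real ^ 'r \<Rightarrow> real" where
  "tau p lam k m = real k / real p * (\<Sum>i\<in>UNIV. lam i * (m $ i) ^ k)"

definition eta :: "('r::finite \<Rightarrow> real) \<Rightarrow> nat \<Rightarrow> real ^ 'r \<Rightarrow> real" where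
  "eta lam k m = (\<Sum>i\<in>UNIV. lam i powr (- 2 / (real k - 2)) * (if m $ i \<noteq> 0 then 1 else 0))"

definition tau_c :: "nat \<Rightarrow> real" where
  "tau_c p = (real p - 2) / sqrt (2 * real p * (real p - 1))"

text \<open>The two branches agree at \<open>k = p\<close>.\<close>

definition eta_c :: "nat \<Rightarrow> nat \<Rightarrow> real" where
  "eta_c p k =
     (if k \<ge> p
      then (real k - 2) *
           (2 * (real k)\<^sup>2 / (real p * (real k - 1) ^ (k - 1))) powr (1 / (real k - 2))
      else (real p - 2) *
           (2 * (real k)\<^sup>2 / (real p * (real p - 1) ^ (k - 1))) powr (1 / (real k - 2)))"

end

theory Submission
  imports Defs "HOL-Complex_Analysis.Cauchy_Integral_Formula"
begin

text \<open>
  Write \<open>t\<close> for \<open>tau m\<close> and \<open>\<rho>\<close> for \<open>\<parallel>m\<parallel>\<^sup>2\<close>. As \<open>x\<close> and \<open>y\<close> differ by a constant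
  depending on \<open>m\<close>, the maximum over \<open>x\<close> is a maximum over \<open>y\<close> of
  \<open>Omega (c y) - (y - t)\<^sup>2\<close> with \<open>c\<^sup>2 = 2 p / (p - 1)\<close>. The potential \<open>Omega\<close> is \<open>z\<^sup>2 / 4 - 1 / 2\<close>
  on \<open>[-2, 2]\<close>, and \<open>Omega (w + 1 / w) = ln w + 1 / (2 w\<^sup>2)\<close> for \<open>w \<ge> 1\<close>. The hypothesis
  \<open>t \<ge> tau_c\<close> says exactly that the maximiser lies at some \<open>c y = s + 1 / s\<close> with \<open>s \<ge> 1\<close>;
  then \<open>u = s \<surd>(p - 1)\<close> satisfies \<open>u - 1 / u = \<surd>(2 p) t\<close>, and everything becomes rational in \<open>u\<close>
  up to one logarithm (\<open>Sigma_tot_eq\<close>): with \<open>v = u\<^sup>2\<close>,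
  \<open>2 \<Sigma> = v - 1 + ln (v (1 - \<rho>)) - (2 k\<^sup>2 / p) \<Sum>\<^sub>i \<lambda>\<^sub>i\<^sup>2 m\<^sub>i^(2 k - 2)\<close>.

  Cauchy-Schwarz bounds the last sum from below by \<open>(\<Sum>\<^sub>i \<lambda>\<^sub>i m\<^sub>i^k)\<^sup>2 / \<rho>\<close>
  (\<open>weighted_power_sums\<close>), which turns the subtracted term into \<open>(v - 1)\<^sup>2 / (v \<rho>)\<close>. Since
  \<open>ln x \<le> x - 1\<close> with \<open>x = v (1 - \<rho>)\<close>, what remains is at most minus a square
  (\<open>log_free_energy_bound\<close>). Hence \<open>\<Sigma> \<le> 0\<close>, with equality iff both inequalities are equalities:
  \<open>\<lambda>\<^sub>i m\<^sub>i^(k - 2)\<close> is constant on the support of \<open>m\<close>, and \<open>v (1 - \<rho>) = 1\<close>, which is the stated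
  relation between \<open>t\<close> and \<open>\<rho>\<close>.

  In the equality case the common value of \<open>\<lambda>\<^sub>i m\<^sub>i^(k - 2)\<close> is determined by \<open>\<rho>\<close>, which gives
  \<open>eta^(k - 2) = (2 k\<^sup>2 / p) \<rho>^(k - 2) (1 - \<rho>)\<close>. Also \<open>v \<ge> p - 1\<close>, so \<open>\<rho> \<ge> (p - 2) / (p - 1)\<close>.
  The number \<open>eta_c\<close> is the largest value of the right-hand side (after taking the root) under this
  constraint (\<open>eta_le_eta_c\<close>), so \<open>eta > eta_c\<close> excludes equality.

  The formula for \<open>Omega\<close> is obtained from the map \<open>w \<mapsto> w + 1 / w\<close>, which sends the unit circle
  onto \<open>[-2, 2]\<close> and pulls the semicircle law back to the weight \<open>1 - cos (2 \<theta>)\<close>. Off the support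
  the integral is a circle average of a holomorphic function; the bulk is reached by letting
  \<open>\<bar>w\<bar>\<close> decrease to 1.
\<close>

section \<open>The logarithmic potential of the semicircle law\<close>

text \<open>
  On the unit circle \<open>ln \<bar>w - \<zeta>\<bar>\<close> is the real part of \<open>Ln (1 - \<zeta> / w) + ln \<bar>w\<bar>\<close>, which is
  holomorphic beyond the closed unit disc. Its average against a trigonometric polynomial only sees
  finitely many Taylor coefficients at 0.
\<close>

lemma log_circle_integral:
  fixes w :: complex
  assumes w: "cmod w > 1"
  shows "((\<lambda>s. ln (cmod (w - cis (2 * pi * s))) * (1 - cos (4 * pi * s)))
    has_integral (ln (cmod w) + Re (1 / w\<^sup>2) / 4)) {0..1}"
proof -
  define f where "f = (\<lambda>\<zeta>. Ln (1 - \<zeta> / w) + of_real (ln (cmod w)))"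
  have w0: "w \<noteq> 0" using w by auto
  have pos: "Re (1 - \<zeta> / w) > 0" if "\<zeta> \<in> ball 0 (cmod w)" for \<zeta>
  proof -
    have "cmod (\<zeta> / w) < 1" using that w by (simp add: norm_divide divide_less_eq)
    then show ?thesis using complex_Re_le_cmod[of "\<zeta> / w"] by simp
  qed
  have deriv_f: "(f has_field_derivative (- 1 / (w - \<zeta>))) (at \<zeta>)" if "\<zeta> \<in> ball 0 (cmod w)" for \<zeta>
  proof -
    have "1 - \<zeta> / w \<notin> \<real>\<^sub>\<le>\<^sub>0" "1 - \<zeta> / w \<noteq> 0"
      using pos[OF that] by (auto simp: complex_nonpos_Reals_iff simp del: minus_complex.sel)
    then show ?thesis
      unfolding f_def using w0
      by (auto intro!: derivative_eq_intros simp: field_simps)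
  qed
  have hol: "f holomorphic_on ball 0 (cmod w)"
    using deriv_f holomorphic_on_open by blast
  have cb: "cball 0 1 \<subseteq> ball 0 (cmod w)" using w by auto
  have hol1: "f holomorphic_on cball 0 1" using hol cb holomorphic_on_subset by blast
  have f0: "f 0 = of_real (ln (cmod w))" by (simp add: f_def)
  have d2: "(deriv ^^ 2) f 0 = - 1 / w\<^sup>2"
  proof -
    have ev: "eventually (\<lambda>\<zeta>. deriv f \<zeta> = - 1 / (w - \<zeta>)) (nhds 0)"
      by (rule eventually_mono[OF eventually_nhds_in_open[of "ball 0 (cmod w)" 0]])
        (use w0 in \<open>auto intro!: DERIV_imp_deriv deriv_f[unfolded minus_divide_left[symmetric]]\<close>)
    have "(deriv ^^ 2) f 0 = deriv (deriv f) 0" by (simp add: numeral_2_eq_2)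
    also have "\<dots> = deriv (\<lambda>\<zeta>. - 1 / (w - \<zeta>)) 0" using ev by (rule deriv_cong_ev) simp
    also have "\<dots> = - 1 / w\<^sup>2"
      by (rule DERIV_imp_deriv) (use w0 in \<open>auto intro!: derivative_eq_intros simp: power2_eq_square\<close>)
    finally show ?thesis .
  qed
  \<comment> \<open>With \<open>\<theta> = 2 \<pi> s\<close>, the weight \<open>1 - cos (2 \<theta>)\<close> is \<open>1 - (\<zeta>\<^sup>2 + \<zeta>\<^sup>-\<^sup>2) / 2\<close> on
    the unit circle, so three coefficients of \<open>f\<close> are needed.\<close>
  have i1: "((\<lambda>\<zeta>. f \<zeta> / \<zeta>) has_contour_integral (2 * of_real pi * \<i> * of_real (ln (cmod w)))) (circlepath 0 1)"
    using Cauchy_integral_circlepath_simple[OF hol1, of 0] by (simp add: f0)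
  have i2: "((\<lambda>\<zeta>. (f \<zeta> * \<zeta>\<^sup>2) / \<zeta>) has_contour_integral 0) (circlepath 0 1)"
    using Cauchy_integral_circlepath_simple[of "\<lambda>\<zeta>. f \<zeta> * \<zeta>\<^sup>2" 0 1 0]
      holomorphic_on_mult[OF hol1 holomorphic_on_power[OF holomorphic_on_ident]]
    by simp
  have i3: "((\<lambda>\<zeta>. f \<zeta> / \<zeta> ^ 3) has_contour_integral (2 * pi * \<i> / 2 * (- 1 / w\<^sup>2))) (circlepath 0 1)"
    using Cauchy_has_contour_integral_higher_derivative_circlepath[of 0 1 f 0 2]
      holomorphic_on_imp_continuous_on[OF hol1] holomorphic_on_subset[OF hol1 ball_subset_cball]
    by (simp add: d2 flip: numeral_2_eq_2 numeral_3_eq_3)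
  define F where "F = (\<lambda>\<zeta>. f \<zeta> / \<zeta> - ((f \<zeta> * \<zeta>\<^sup>2) / \<zeta> + f \<zeta> / \<zeta> ^ 3) / 2)"
  have "(F has_contour_integral
      (2 * of_real pi * \<i> * of_real (ln (cmod w)) - (0 + 2 * pi * \<i> / 2 * (- 1 / w\<^sup>2)) / 2)) (circlepath 0 1)"
    unfolding F_def by (intro has_contour_integral_diff has_contour_integral_div has_contour_integral_add i1 i2 i3)
  then have "((\<lambda>s. F (cis (2 * pi * s)) * (2 * pi * \<i> * cis (2 * pi * s))) has_integral
      (2 * pi * \<i> * (of_real (ln (cmod w)) + (1 / w\<^sup>2) / 4))) {0..1}"
    unfolding has_contour_integral vector_derivative_circlepath
    unfolding circlepath by (simp add: cis_conv_exp mult_ac field_simps)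
  note int_2pi = has_integral_divide[OF this, of "2 * pi * \<i>"]
  have "a * (2 * pi * \<i> * b) / (2 * pi * \<i>) = a * b" "2 * pi * \<i> * a / (2 * pi * \<i>) = a"
    for a b :: complex
    by (simp_all add: mult.left_commute[of a])
  then have "((\<lambda>s. F (cis (2 * pi * s)) * cis (2 * pi * s)) has_integral
      (of_real (ln (cmod w)) + (1 / w\<^sup>2) / 4)) {0..1}"
    using int_2pi by (simp only:)
  then have "((\<lambda>s. Re (F (cis (2 * pi * s)) * cis (2 * pi * s))) has_integral
      Re (of_real (ln (cmod w)) + (1 / w\<^sup>2) / 4)) {0..1}"
    using has_integral_linear[OF _ bounded_linear_Re] unfolding o_def by blast
  moreover have "Re (F (cis (2 * pi * s)) * cis (2 * pi * s))
      = ln (cmod (w - cis (2 * pi * s))) * (1 - cos (4 * pi * s))" for s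
  proof -
    define e where "e = cis (2 * pi * s)"
    have e0: "e \<noteq> 0" by (simp add: e_def)
    have "e\<^sup>2 = cis (4 * pi * s)" by (simp add: e_def Complex.DeMoivre mult.assoc)
    moreover from this have "1 / e\<^sup>2 = cis (- (4 * pi * s))" by (simp only: cis_inverse flip: inverse_eq_divide)
    ultimately have e2: "(e\<^sup>2 + 1 / e\<^sup>2) / 2 = of_real (cos (4 * pi * s))"
      by (simp add: complex_eq_iff)
    have "F e * e = f e * (1 - (e\<^sup>2 + 1 / e\<^sup>2) / 2)"
      using e0 by (simp add: F_def field_simps power2_eq_square power3_eq_cube)
    then have "F e * e = f e * of_real (1 - cos (4 * pi * s))" unfolding e2 by simp
    then have 1: "Re (F e * e) = Re (f e) * (1 - cos (4 * pi * s))"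
      by (simp only: Re_complex_of_real Im_complex_of_real times_complex.sel)
    have ne: "1 - e / w \<noteq> 0" using pos[of e] w by (auto simp: e_def)
    have "Re (f e) = ln (cmod (1 - e / w)) + ln (cmod w)" using ne by (simp add: f_def)
    also have "\<dots> = ln (cmod ((1 - e / w) * w))"
      unfolding norm_mult using ne w0 by (subst ln_mult_pos) auto
    also have "(1 - e / w) * w = w - e" using w0 by (simp add: field_simps)
    finally show ?thesis using 1 by (simp add: e_def)
  qed
  moreover have "Re (of_real (ln (cmod w)) + (1 / w\<^sup>2) / 4) = ln (cmod w) + Re (1 / w\<^sup>2) / 4"
    by (simp del: divide_divide_eq_left)
  ultimately show ?thesis by (simp only:)
qed

lemma one_minus_cos_integral: "((\<lambda>s. 1 - cos (4 * pi * s)) has_integral 1) {0..1}"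
proof -
  have "((\<lambda>s. 1 - cos (4 * pi * s)) has_integral
      ((1 - sin (4 * pi * 1) / (4 * pi)) - (0 - sin (4 * pi * 0) / (4 * pi)))) {0..1}"
    by (rule fundamental_theorem_of_calculus)
      (auto intro!: derivative_eq_intros simp flip: has_real_derivative_iff_has_vector_derivative)
  moreover have "sin (4 * pi) = 0" using sin_npi[of 4] by simp
  ultimately show ?thesis by simp
qed

text \<open>
  The substitution \<open>t = 2 cos (2 \<pi> s)\<close>. Each of the two half circles covers \<open>[-2, 2]\<close> once and
  carries half of the integral; using the whole circle makes Cauchy's formula applicable.
\<close>

lemma semicircle_integral_circle:
  fixes h :: "real \<Rightarrow> real"
  assumes cont: "continuous_on {-2..2} h" and meas: "h \<in> borel_measurable borel"
  shows "integrable semicircle h"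
    and "((\<lambda>s. h (2 * cos (2 * pi * s)) * (1 - cos (4 * pi * s))) has_integral (\<integral>t. h t \<partial>semicircle)) {0..1}"
proof -
  define d where "d = (\<lambda>x::real. 1 / (2 * pi) * sqrt (4 - x\<^sup>2))"
  define d' where "d' = (\<lambda>x. d x * indicator {-2..2} x)"
  have ind: "{x::real. \<bar>x\<bar> \<le> 2} = {-2..2}" by auto
  have sc: "semicircle = density lborel (\<lambda>x. ennreal (d' x))"
    unfolding semicircle_def d'_def d_def ind ..
  have d'0: "AE x in lborel. 0 \<le> d' x"
  proof (rule AE_I2)
    fix x :: real
    have "x\<^sup>2 \<le> 4" if "x \<in> {-2..2}"
      using that abs_le_square_iff[of x 2] by auto
    then show "0 \<le> d' x" by (auto simp: d'_def d_def indicator_def)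
  qed
  have [measurable]: "d' \<in> borel_measurable lborel" unfolding d'_def d_def by measurable
  note meas[measurable]
  have contd: "continuous_on {-2..2} d" unfolding d_def by (intro continuous_intros)
  have si: "set_integrable lborel {-2..2} (\<lambda>x. d x * h x)"
    by (intro borel_integrable_atLeastAtMost' continuous_on_mult contd cont)
  have "integrable semicircle h \<longleftrightarrow> integrable lborel (\<lambda>x. d' x *\<^sub>R h x)"
    unfolding sc by (rule integrable_density) (use d'0 in auto)
  then show "integrable semicircle h"
    using si by (simp add: set_integrable_def d'_def mult_ac)
  have "(\<integral>t. h t \<partial>semicircle) = (\<integral>x. d' x *\<^sub>R h x \<partial>lborel)"
    unfolding sc by (rule integral_density) (use d'0 in auto)
  also have "\<dots> = (LINT x:{-2..2}|lborel. d x * h x)"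
    by (simp add: set_lebesgue_integral_def d'_def mult_ac)
  also have "\<dots> = integral {-2..2} (\<lambda>x. d x * h x)"
    using set_borel_integral_eq_integral(2)[OF si] .
  finally have I: "(\<integral>t. h t \<partial>semicircle) = integral {-2..2} (\<lambda>x. d x * h x)" .
  define J where "J = (\<integral>t. h t \<partial>semicircle)"
  define H where "H = (\<lambda>s. h (2 * cos (2 * pi * s)) * (1 - cos (4 * pi * s)))"
  have c1: "cos (2 * pi * (1/2)) = -1" "cos (2 * pi * 1) = 1" by auto
  have "((\<lambda>s. (-(4 * pi * sin (2 * pi * s))) *\<^sub>R (\<lambda>x. d x * h x) (2 * cos (2 * pi * s)))
      has_integral (integral {2 * cos (2 * pi * (1/2))..2 * cos (2 * pi * 1)} (\<lambda>x. d x * h x))) {1/2..1}"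
  proof (rule has_integral_substitution[where c = "-2" and d = 2])
    show "(\<lambda>x. 2 * cos (2 * pi * x)) ` {1/2..1} \<subseteq> {-2..2}"
      using cos_ge_minus_one cos_le_one by (fastforce)
  qed (auto intro!: continuous_on_mult contd cont derivative_eq_intros)
  then have "((\<lambda>s. (-(4 * pi * sin (2 * pi * s))) *\<^sub>R (\<lambda>x. d x * h x) (2 * cos (2 * pi * s)))
      has_integral J) {1/2..1}"
    unfolding c1 J_def I by simp
  moreover have "(-(4 * pi * sin (2 * pi * s))) *\<^sub>R (\<lambda>x. d x * h x) (2 * cos (2 * pi * s)) = 2 * H s"
    if "s \<in> {1/2..1}" for s
  proof -
    have s: "sin (2 * pi * s) \<le> 0"
    proof (cases "s = 1")
      case False
      then have "pi * (2 * s) < pi * 2" "pi * 1 \<le> pi * (2 * s)" using that by (auto intro!: mult_left_mono)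
      then show ?thesis by (intro sin_le_zero) (auto simp: mult_ac)
    qed auto
    have "4 - (2 * cos (2 * pi * s))\<^sup>2 = (2 * sin (2 * pi * s))\<^sup>2"
      by (simp add: power_mult_distrib sin_squared_eq)
    then have "sqrt (4 - (2 * cos (2 * pi * s))\<^sup>2) = - (2 * sin (2 * pi * s))"
      using s by (simp only: real_sqrt_abs)
    moreover have "1 - cos (4 * pi * s) = 2 * (sin (2 * pi * s))\<^sup>2"
      using cos_double_sin[of "2 * pi * s"] by (simp add: mult.assoc)
    ultimately show ?thesis by (simp add: d_def H_def power2_eq_square)
  qed
  ultimately have h1: "((\<lambda>s. 2 * H s) has_integral J) {1/2..1}"
    by (rule has_integral_eq[rotated]) auto
  then have h1: "(H has_integral J / 2) {1/2..1}"
    using has_integral_divide[OF h1, of 2] by simp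
  have Hsym: "H (1 - s) = H s" for s
  proof -
    have "2 * pi * (1 - s) = 2 * pi - 2 * pi * s" "4 * pi * (1 - s) = 4 * pi - 4 * pi * s"
      by (auto simp: algebra_simps)
    moreover have "cos (4 * pi) = 1" "sin (4 * pi) = 0" using cos_npi[of 4] sin_npi[of 4] by auto
    ultimately show ?thesis unfolding H_def by (simp only: cos_diff) simp
  qed
  have im: "(\<lambda>x. - x + 1) ` {1/2..1} = {0..1/2::real}"
    by (auto simp: image_iff intro!: bexI[where x = "1 - _"])
  have h2: "(H has_integral J / 2) {0..1/2}"
    using has_integral_affinity[of H "J/2" "1/2" 1 "-1" 1] h1
    by (simp add: im Hsym)
  have "(H has_integral (J / 2 + J / 2)) {0..1}"
    by (rule has_integral_combine[OF _ _ h2 h1]) auto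
  then show "((\<lambda>s. h (2 * cos (2 * pi * s)) * (1 - cos (4 * pi * s))) has_integral (\<integral>t. h t \<partial>semicircle)) {0..1}"
    by (simp add: H_def J_def)
qed

text \<open>
  The points of the circle lying over \<open>2 cos \<theta>\<close> are \<open>cis \<theta>\<close> and \<open>cis (- \<theta>)\<close>, so the distance
  between two values of \<open>w + 1 / w\<close> factors through distances upstairs.
\<close>

lemma norm_joukowski_diff:
  fixes w :: complex
  assumes "w \<noteq> 0"
  shows "cmod (w + 1 / w - of_real (2 * cos \<theta>)) = cmod (w - cis \<theta>) * cmod (w - cis (- \<theta>)) / cmod w"
proof -
  have c: "cis \<theta> + cis (- \<theta>) = of_real (2 * cos \<theta>)" "cis \<theta> * cis (- \<theta>) = 1"
    by (auto simp: complex_eq_iff cis_mult)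
  have "(w + 1 / w - of_real (2 * cos \<theta>)) * w = w * w - w * (cis \<theta> + cis (- \<theta>)) + cis \<theta> * cis (- \<theta>)"
    using assms unfolding c by (simp add: ring_distribs mult_ac)
  also have "\<dots> = (w - cis \<theta>) * (w - cis (- \<theta>))" by (simp only: algebra_simps)
  finally have "w + 1 / w - of_real (2 * cos \<theta>) = (w - cis \<theta>) * (w - cis (- \<theta>)) / w"
    using assms by (simp only: nonzero_eq_divide_eq not_False_eq_True)
  then show ?thesis by (simp add: norm_mult norm_divide)
qed

lemma semicircle_const:
  fixes c :: real
  shows "integrable semicircle (\<lambda>t. c)" and "(\<integral>t. c \<partial>semicircle) = c"
proof -
  show "integrable semicircle (\<lambda>t. c)" by (rule semicircle_integral_circle) auto
  have "((\<lambda>s. c * (1 - cos (4 * pi * s))) has_integral (\<integral>t. c \<partial>semicircle)) {0..1}"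
    by (rule semicircle_integral_circle(2)) auto
  then show "(\<integral>t. c \<partial>semicircle) = c"
    using has_integral_unique[OF _ has_integral_mult_right[OF one_minus_cos_integral, of c]] by fastforce
qed

text \<open>
  By the factorisation of the distance, the potential is the sum of two circle averages, one for
  \<open>w\<close> and one for its conjugate.
\<close>

lemma log_potential_off_support:
  fixes w :: complex
  assumes w: "cmod w > 1"
  shows "integrable semicircle (\<lambda>t. ln (cmod (w + 1 / w - of_real t)))"
    and "(\<integral>t. ln (cmod (w + 1 / w - of_real t)) \<partial>semicircle) = ln (cmod w) + Re (1 / w\<^sup>2) / 2"
proof -
  define h where "h = (\<lambda>t::real. ln (cmod (w + 1 / w - of_real t)))"
  have w0: "w \<noteq> 0" using w by auto
  have cis_ne: "cmod (w - cis a) > 0" for a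
    using w norm_cis[of a] by (metis eq_iff_diff_eq_0 less_irrefl zero_less_norm_iff)
  have ne: "cmod (w + 1 / w - of_real t) > 0" if "t \<in> {-2..2}" for t
  proof -
    have "t = 2 * cos (arccos (t / 2))" using that by (simp add: cos_arccos)
    then show ?thesis
      using norm_joukowski_diff[OF w0, of "arccos (t / 2)"] cis_ne w0
      by (metis divide_pos_pos mult_pos_pos zero_less_norm_iff)
  qed
  have cont: "continuous_on {-2..2} h"
    unfolding h_def using ne by (intro continuous_intros) force+
  have meas: "h \<in> borel_measurable borel" unfolding h_def by measurable
  show "integrable semicircle (\<lambda>t. ln (cmod (w + 1 / w - of_real t)))"
    using semicircle_integral_circle(1)[OF cont meas] by (simp add: h_def)
  have h_circle: "h (2 * cos \<theta>) = ln (cmod (w - cis \<theta>)) + ln (cmod (cnj w - cis \<theta>)) - ln (cmod w)" for \<theta>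
  proof -
    have "cmod (w - cis (- \<theta>)) = cmod (cnj w - cis \<theta>)"
      by (metis cis_cnj complex_cnj_cnj complex_cnj_diff complex_mod_cnj)
    moreover have "cmod (w - cis (- \<theta>)) > 0" by (rule cis_ne)
    ultimately show ?thesis
      unfolding h_def norm_joukowski_diff[OF w0] using cis_ne[of \<theta>] w0
      by (simp add: ln_div ln_mult)
  qed
  have "((\<lambda>s. ln (cmod (w - cis (2 * pi * s))) * (1 - cos (4 * pi * s))
        + ln (cmod (cnj w - cis (2 * pi * s))) * (1 - cos (4 * pi * s))
        - ln (cmod w) * (1 - cos (4 * pi * s)))
      has_integral ((ln (cmod w) + Re (1 / w\<^sup>2) / 4) + (ln (cmod (cnj w)) + Re (1 / (cnj w)\<^sup>2) / 4)
        - ln (cmod w) * 1)) {0..1}"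
    by (intro has_integral_add has_integral_diff has_integral_mult_right log_circle_integral
        one_minus_cos_integral) (use w in auto)
  then have "((\<lambda>s. h (2 * cos (2 * pi * s)) * (1 - cos (4 * pi * s))) has_integral
      (ln (cmod w) + (Re (1 / w\<^sup>2) / 4 + Re (1 / (cnj w)\<^sup>2) / 4))) {0..1}"
    by (simp add: h_circle algebra_simps)
  moreover have "Re (1 / (cnj w)\<^sup>2) = Re (1 / w\<^sup>2)"
    by (metis complex_cnj_divide complex_cnj_one complex_cnj_power complex_cnj_cnj cnj.sel(1))
  ultimately have "((\<lambda>s. h (2 * cos (2 * pi * s)) * (1 - cos (4 * pi * s))) has_integral
      (ln (cmod w) + Re (1 / w\<^sup>2) / 2)) {0..1}" by simp
  then show "(\<integral>t. ln (cmod (w + 1 / w - of_real t)) \<partial>semicircle) = ln (cmod w) + Re (1 / w\<^sup>2) / 2"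
    using has_integral_unique[OF semicircle_integral_circle(2)[OF cont meas]] by (simp add: h_def)
qed

lemma Omega_off_support:
  fixes w :: real
  assumes "\<bar>w\<bar> > 1"
  shows "Omega (w + 1 / w) = ln \<bar>w\<bar> + 1 / (2 * w\<^sup>2)"
proof -
  have "cmod (of_real w + 1 / of_real w - of_real t) = \<bar>w + 1 / w - t\<bar>" for t
  proof -
    have "complex_of_real w + 1 / of_real w - of_real t = of_real (w + 1 / w - t)" by simp
    then show ?thesis by (simp only: norm_of_real)
  qed
  moreover have "Re (1 / (of_real w)\<^sup>2) = 1 / w\<^sup>2"
  proof -
    have "1 / (complex_of_real w)\<^sup>2 = of_real (1 / w\<^sup>2)" by simp
    then show ?thesis by (simp only: Re_complex_of_real)
  qed
  ultimately show ?thesis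
    using log_potential_off_support(2)[of "of_real w"] assms by (simp add: Omega_def)
qed

lemma semicircle_density_measurable:
  "(\<lambda>x. ennreal (1 / (2 * pi) * sqrt (4 - x\<^sup>2) * indicator {x. \<bar>x\<bar> \<le> 2} x)) \<in> borel_measurable lborel"
  by measurable

lemma AE_semicircle_neq: "AE t in semicircle. t \<noteq> x"
  unfolding semicircle_def AE_density[OF semicircle_density_measurable]
  using AE_lborel_singleton[of x] by eventually_elim simp

lemma AE_semicircle_support: "AE t in semicircle. t \<in> {-2..2}"
  unfolding semicircle_def AE_density[OF semicircle_density_measurable]
proof (rule AE_I2, rule impI)
  fix x :: real
  assume "0 < ennreal (1 / (2 * pi) * sqrt (4 - x\<^sup>2) * indicator {x. \<bar>x\<bar> \<le> 2} x)"
  then have "x \<in> {x. \<bar>x\<bar> \<le> 2}" by (cases "x \<in> {x. \<bar>x\<bar> \<le> 2}") auto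
  then show "x \<in> {-2..2}" by auto
qed

text \<open>
  This monotonicity allows monotone convergence when a point approaches the circle radially.
\<close>

lemma dist_ray_circle_mono:
  assumes "1 \<le> r" "r \<le> r'"
  shows "cmod (of_real r * cis a - cis b) \<le> cmod (of_real r' * cis a - cis b)"
proof -
  have eq: "(cmod (of_real r * cis a - cis b))\<^sup>2 = (r - cos (a - b))\<^sup>2 + (sin (a - b))\<^sup>2" for r
  proof -
    have "(cmod (of_real r * cis a - cis b))\<^sup>2 = (r * cos a - cos b)\<^sup>2 + (r * sin a - sin b)\<^sup>2"
      by (simp add: cmod_power2)
    also have "\<dots> = r\<^sup>2 * ((cos a)\<^sup>2 + (sin a)\<^sup>2) + ((cos b)\<^sup>2 + (sin b)\<^sup>2) - 2 * r * cos (a - b)"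
      unfolding cos_diff by algebra
    also have "\<dots> = r\<^sup>2 + ((cos (a - b))\<^sup>2 + (sin (a - b))\<^sup>2) - 2 * r * cos (a - b)" by simp
    also have "\<dots> = (r - cos (a - b))\<^sup>2 + (sin (a - b))\<^sup>2"
      by (simp only: power2_diff)
    finally show ?thesis .
  qed
  have "0 \<le> r - cos (a - b)" using assms(1) cos_le_one[of "a - b"] by linarith
  then have "(r - cos (a - b))\<^sup>2 \<le> (r' - cos (a - b))\<^sup>2" using assms(2) by (intro power_mono) auto
  then show ?thesis by (metis eq add_le_cancel_right norm_ge_zero power2_le_imp_le)
qed

text \<open>
  Write \<open>x = w + 1 / w\<close> with \<open>w = cis a\<close> and approach \<open>w\<close> along \<open>r w\<close> with \<open>r\<close> decreasing to 1.
  The functions \<open>ln \<bar>r w + 1 / (r w) - t\<bar> + ln r\<close> decrease pointwise on the support and their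
  integrals converge, so monotone convergence yields the value at \<open>x\<close> together with the
  integrability of the logarithmic singularity.
\<close>

lemma Omega_inside:
  fixes x :: real
  assumes x: "\<bar>x\<bar> \<le> 2"
  shows "Omega x = x\<^sup>2 / 4 - 1 / 2"
proof -
  define a where "a = arccos (x / 2)"
  have xa: "x = 2 * cos a" using x by (simp add: a_def cos_arccos abs_le_iff)
  define r where "r = (\<lambda>n. 1 + 1 / real (Suc n))"
  define W where "W = (\<lambda>n. of_real (r n) * cis a)"
  have r1: "r n > 1" for n by (simp add: r_def)
  have rdec: "r n \<le> r m" if "m \<le> n" for m n using that by (simp add: r_def frac_le)
  have rlim: "r \<longlonglongrightarrow> 1"
    unfolding r_def using tendsto_add[OF tendsto_const[of "1::real"] LIMSEQ_inverse_real_of_nat]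
    by (simp add: inverse_eq_divide)
  have Wnorm: "cmod (W n) = r n" for n using r1[of n] by (simp add: W_def norm_mult)
  have W0: "W n \<noteq> 0" for n using Wnorm[of n] r1[of n] by auto
  define f where "f = (\<lambda>n t. - (ln (cmod (W n + 1 / W n - of_real t)) + ln (r n)))"
  have Wsq: "Re (1 / (W n)\<^sup>2) = cos (2 * a) / (r n)\<^sup>2" for n
  proof -
    have "1 / (W n)\<^sup>2 = of_real (1 / (r n)\<^sup>2) * cis (- (2 * a))"
      by (simp add: W_def power_mult_distrib Complex.DeMoivre divide_inverse flip: cis_inverse)
    then show ?thesis by simp
  qed
  have fint: "integrable semicircle (f n)" for n
    unfolding f_def using log_potential_off_support(1)[of "W n"] r1[of n]
    by (intro integrable_minus Bochner_Integration.integrable_add semicircle_const(1)) (simp_all add: Wnorm)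
  have fval: "integral\<^sup>L semicircle (f n) = - (2 * ln (r n) + cos (2 * a) / (2 * (r n)\<^sup>2))" for n
    unfolding f_def using log_potential_off_support[of "W n"] r1[of n] semicircle_const[of "ln (r n)"]
    by (simp add: Wnorm Wsq del: lebesgue_integral_const)
  have ilim: "(\<lambda>n. integral\<^sup>L semicircle (f n)) \<longlonglongrightarrow> - (x\<^sup>2 / 4 - 1 / 2)"
  proof -
    have "(\<lambda>n. - (2 * ln (r n) + cos (2 * a) / (2 * (r n)\<^sup>2)))
        \<longlonglongrightarrow> - (2 * ln 1 + cos (2 * a) / (2 * 1\<^sup>2))"
      by (intro tendsto_intros rlim) auto
    moreover have "cos (2 * a) / 2 = x\<^sup>2 / 4 - 1 / 2"
      unfolding cos_double_cos xa by (simp add: power_mult_distrib diff_divide_distrib)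
    ultimately show ?thesis by (simp add: fval)
  qed
  have mono: "AE t in semicircle. mono (\<lambda>n. f n t)"
  proof (rule AE_mp[OF AE_semicircle_support], rule AE_I2, rule impI)
    fix t :: real assume t: "t \<in> {-2..2}"
    define b where "b = arccos (t / 2)"
    have tb: "t = 2 * cos b" using t by (simp add: b_def cos_arccos)
    have pos: "cmod (W n - cis c) > 0" for n c
      using Wnorm[of n] r1[of n] norm_cis[of c] by (metis eq_iff_diff_eq_0 less_irrefl zero_less_norm_iff)
    have fb: "f n t = - (ln (cmod (W n - cis b)) + ln (cmod (W n - cis (- b))))" for n
      unfolding f_def tb norm_joukowski_diff[OF W0] using pos[of n b] pos[of n "- b"] r1[of n]
      by (simp add: Wnorm ln_div ln_mult)
    show "mono (\<lambda>n. f n t)"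
    proof (rule monoI)
      fix m n :: nat assume mn: "m \<le> n"
      have "cmod (W n - cis c) \<le> cmod (W m - cis c)" for c
        unfolding W_def using r1[of n] rdec[OF mn] by (intro dist_ray_circle_mono) auto
      then have "ln (cmod (W n - cis c)) \<le> ln (cmod (W m - cis c))" for c
        using pos by (intro ln_mono) auto
      from this[of b] this[of "- b"] show "f m t \<le> f n t" unfolding fb by linarith
    qed
  qed
  have lim: "AE t in semicircle. (\<lambda>n. f n t) \<longlonglongrightarrow> - ln \<bar>x - t\<bar>"
  proof (rule AE_mp[OF AE_semicircle_neq[of x]], rule AE_I2, rule impI)
    fix t :: real assume t: "t \<noteq> x"
    have "W \<longlonglongrightarrow> of_real 1 * cis a"
      unfolding W_def by (intro tendsto_intros rlim)
    then have "(\<lambda>n. W n + 1 / W n - of_real t) \<longlonglongrightarrow> cis a + 1 / cis a - of_real t"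
      by (intro tendsto_intros) auto
    also have "cis a + 1 / cis a - of_real t = of_real (x - t)"
      by (simp add: xa complex_eq_iff divide_inverse)
    finally have "(\<lambda>n. cmod (W n + 1 / W n - of_real t)) \<longlonglongrightarrow> cmod (of_real (x - t))"
      by (rule tendsto_norm)
    from tendsto_ln[OF this] have "(\<lambda>n. ln (cmod (W n + 1 / W n - of_real t)))
        \<longlonglongrightarrow> ln (cmod (of_real (x - t) :: complex))"
      using t by (simp only: norm_of_real)
    moreover have "(\<lambda>n. ln (r n)) \<longlonglongrightarrow> ln 1" by (intro tendsto_ln rlim) auto
    ultimately have "(\<lambda>n. f n t) \<longlonglongrightarrow> - (ln (cmod (of_real (x - t) :: complex)) + ln 1)"
      unfolding f_def by (intro tendsto_minus tendsto_add)
    also have "cmod (of_real (x - t)) = \<bar>x - t\<bar>" by (simp only: norm_of_real)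
    finally show "(\<lambda>n. f n t) \<longlonglongrightarrow> - ln \<bar>x - t\<bar>" by simp
  qed
  have "integral\<^sup>L semicircle (\<lambda>t. - ln \<bar>x - t\<bar>) = - (x\<^sup>2 / 4 - 1 / 2)"
    by (rule integral_monotone_convergence[OF fint mono lim ilim])
      (simp add: semicircle_def)
  then have "- Omega x = - (x\<^sup>2 / 4 - 1 / 2)" unfolding Omega_def by (simp only: integral_minus)
  then show ?thesis by linarith
qed

text \<open>
  The parametrisation \<open>w + 1 / w\<close> removes the square roots from the potential outside the bulk.
\<close>

lemma Omega_joukowski:
  fixes w :: real
  assumes "w \<ge> 1"
  shows "Omega (w + 1 / w) = ln w + 1 / (2 * w\<^sup>2)"
    and "Omega (- (w + 1 / w)) = ln w + 1 / (2 * w\<^sup>2)"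
proof -
  show "Omega (w + 1 / w) = ln w + 1 / (2 * w\<^sup>2)"
  proof (cases "w = 1")
    case True
    then show ?thesis using Omega_inside[of 2] by simp
  next
    case False
    then show ?thesis using Omega_off_support[of w] assms by simp
  qed
  show "Omega (- (w + 1 / w)) = ln w + 1 / (2 * w\<^sup>2)"
  proof (cases "w = 1")
    case True
    then show ?thesis using Omega_inside[of "- 2"] by simp
  next
    case False
    then have "\<bar>- w\<bar> > 1" using assms by simp
    moreover have "- (w + 1 / w) = - w + 1 / (- w)" by simp
    ultimately show ?thesis using Omega_off_support[of "- w"] assms by simp
  qed
qed

lemma joukowski_surj:
  fixes z :: real
  assumes "z \<ge> 2"
  obtains w where "w \<ge> 1" "z = w + 1 / w"
proof -
  define w where "w = (z + sqrt (z\<^sup>2 - 4)) / 2"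
  have z4: "z\<^sup>2 \<ge> 4" using power_mono[OF assms, of 2] by simp
  have w1: "w \<ge> 1" using assms z4 by (simp add: w_def add_increasing2)
  have "w * w + 1 = z * w" using z4 by (simp add: w_def field_simps power2_eq_square)
  then have "z = w + 1 / w" using w1 by (simp add: field_simps)
  then show ?thesis using that w1 by blast
qed

section \<open>Maximising over the energy variable\<close>

text \<open>
  In the coordinate \<open>w + 1 / w\<close> this says that \<open>Omega\<close>, whose derivative there is \<open>1 / w\<close>, lies
  below its tangent at \<open>s + 1 / s\<close> on \<open>[2, \<infinity>)\<close>. The derivative in \<open>w\<close> of the gap is
  \<open>(1 / s - 1 / w) (1 - 1 / w\<^sup>2)\<close>, which changes sign at \<open>w = s\<close> only.
\<close>

lemma log_tangent_bound:
  fixes w s :: real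
  assumes "w \<ge> 1" "s \<ge> 1"
  shows "ln w - ln s \<le> w / s - 1 - (1 / s - 1 / w)\<^sup>2 / 2"
proof -
  define h where "h = (\<lambda>w. w / s - 1 - (1 / s - 1 / w)\<^sup>2 / 2 - ln w + ln s)"
  have d: "(h has_real_derivative ((1 / s - 1 / x) * (1 - 1 / x\<^sup>2))) (at x)" if "x \<ge> 1" for x
    unfolding h_def using that assms
    by (auto intro!: derivative_eq_intros simp: power2_eq_square field_simps)
  have hs: "h s = 0" using assms by (simp add: h_def)
  have q: "1 - 1 / x\<^sup>2 \<ge> 0" if "x \<ge> 1" for x :: real
    using that by (simp add: divide_le_eq_1 one_le_power)
  have "h w \<ge> 0"
  proof (cases "s \<le> w")
    case True
    have "h s \<le> h w"
    proof (rule DERIV_nonneg_imp_nondecreasing[OF True])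
      fix x assume x: "s \<le> x" "x \<le> w"
      then have "1 / s - 1 / x \<ge> 0" using assms by (simp add: frac_le)
      then show "\<exists>y. (h has_real_derivative y) (at x) \<and> y \<ge> 0"
        using d[of x] q[of x] x assms by (meson mult_nonneg_nonneg order_trans)
    qed
    then show ?thesis using hs by simp
  next
    case False
    then have ws: "w \<le> s" by simp
    have "h s \<le> h w"
    proof (rule DERIV_nonpos_imp_nonincreasing[OF ws])
      fix x assume x: "w \<le> x" "x \<le> s"
      then have "1 / s - 1 / x \<le> 0" using assms by (simp add: frac_le)
      then show "\<exists>y. (h has_real_derivative y) (at x) \<and> y \<le> 0"
        using d[of x] q[of x] x assms by (meson mult_nonpos_nonneg order_trans)
    qed
    then show ?thesis using hs by simp
  qed
  then show ?thesis by (simp add: h_def)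
qed

text \<open>
  The centre of the penalty is chosen so that \<open>s + 1 / s\<close> is a critical point. Above 2 the bound is
  the tangent inequality; inside the bulk \<open>Omega\<close> is quadratic and \<open>q \<ge> 1\<close> makes the right edge
  \<open>2\<close> optimal; negative \<open>z\<close> below the bulk are no better than \<open>- z\<close> because the centre of the
  penalty is nonnegative.
\<close>

lemma penalised_Omega_max:
  fixes q s :: real
  assumes q: "q \<ge> 1" and s: "s \<ge> 1"
  defines "G \<equiv> \<lambda>z. Omega z - (q * z - (q * s - 1 / (q * s)))\<^sup>2 / (2 * (q\<^sup>2 + 1))"
  shows "G (s + 1 / s) = ln s - 1 / (2 * (q * s)\<^sup>2)"
    and "G z \<le> G (s + 1 / s)"
proof -
  define A where "A = q * s - 1 / (q * s)"
  define r where "r = 2 * (q\<^sup>2 + 1)"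
  have r: "r > 0" by (simp add: r_def add_nonneg_pos)
  have G: "G z = Omega z - (q * z - A)\<^sup>2 / r" for z by (simp add: G_def A_def r_def)
  \<comment> \<open>The value of the linear form under the square at the critical point.\<close>
  define e where "e = (q\<^sup>2 + 1) / (q * s)"
  have e: "q * (s + 1 / s) - A = e"
    using q s by (simp add: A_def e_def field_simps power2_eq_square)
  have er: "2 * q * e / r = 1 / s"
  proof -
    have "2 * q * e / r = (2 * (q\<^sup>2 + 1)) * q / (q * s * r)" by (simp add: e_def mult_ac)
    also have "\<dots> = r * q / (q * s * r)" by (simp only: r_def)
    also have "\<dots> = 1 / s" using q s r by simp
    finally show ?thesis .
  qed
  have e2r: "e\<^sup>2 / r = 1 / (2 * s\<^sup>2) + 1 / (2 * (q * s)\<^sup>2)"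
  proof -
    have "e\<^sup>2 / r = (2 * q * e / r) * (e / (2 * q))" using q by (simp add: power2_eq_square)
    also have "\<dots> = 1 / s * (e / (2 * q))" by (simp only: er)
    also have "\<dots> = 1 / (2 * s\<^sup>2) + 1 / (2 * (q * s)\<^sup>2)"
      using q s by (simp add: e_def field_simps power2_eq_square)
    finally show ?thesis .
  qed
  show Gs: "G (s + 1 / s) = ln s - 1 / (2 * (q * s)\<^sup>2)"
    unfolding G e e2r Omega_joukowski(1)[OF s] by simp
  have A0: "A \<ge> 0"
  proof -
    have "q * s \<ge> 1" using q s by (metis mult_mono' mult_1 zero_le_one)
    then have "1 / (q * s) \<le> 1" by simp
    then show ?thesis using \<open>q * s \<ge> 1\<close> unfolding A_def by linarith
  qed
  \<comment> \<open>The tangent line of \<open>Omega\<close> at \<open>s + 1 / s\<close> cancels the linear part of the penalty there.\<close>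
  have out: "G (w + 1 / w) \<le> G (s + 1 / s)" if w: "w \<ge> 1" for w
  proof -
    define d where "d = (w + 1 / w) - (s + 1 / s)"
    have "Omega (w + 1 / w) - Omega (s + 1 / s) = (ln w - ln s) + 1 / (2 * w\<^sup>2) - 1 / (2 * s\<^sup>2)"
      using w s by (simp add: Omega_joukowski)
    also have "\<dots> \<le> (w / s - 1 - (1 / s - 1 / w)\<^sup>2 / 2) + 1 / (2 * w\<^sup>2) - 1 / (2 * s\<^sup>2)"
      using log_tangent_bound[OF w s] by simp
    also have "\<dots> = d * (1 / s)"
      using w s by (simp add: d_def field_simps power2_eq_square)
    also have "\<dots> = 2 * q * d * e / r" by (simp flip: er)
    finally have 1: "Omega (w + 1 / w) - Omega (s + 1 / s) \<le> 2 * q * d * e / r" .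
    have "q * (w + 1 / w) - A = q * d + e" using e by (simp add: d_def algebra_simps)
    then have "(q * (w + 1 / w) - A)\<^sup>2 - e\<^sup>2 = (q * d)\<^sup>2 + 2 * q * d * e"
      by (simp add: power2_eq_square algebra_simps)
    then have "2 * q * d * e \<le> (q * (w + 1 / w) - A)\<^sup>2 - e\<^sup>2" by simp
    then have "2 * q * d * e / r \<le> (q * (w + 1 / w) - A)\<^sup>2 / r - e\<^sup>2 / r"
      using r by (simp add: divide_right_mono flip: diff_divide_distrib)
    then show ?thesis using 1 unfolding G e by linarith
  qed
  consider "\<bar>z\<bar> \<le> 2" | "z \<ge> 2" | "- z \<ge> 2" by linarith
  then show "G z \<le> G (s + 1 / s)"
  proof cases
    case 1
    have "1 - q\<^sup>2 + q * A = q\<^sup>2 * (s - 1) + (1 - 1 / s)"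
      using q s by (simp add: A_def field_simps power2_eq_square)
    also have "\<dots> \<ge> 0" using s by (intro add_nonneg_nonneg) auto
    finally have qA: "q\<^sup>2 - 1 \<le> q * A" by simp
    have "(2 + z) * (q\<^sup>2 - 1) \<le> 4 * (q\<^sup>2 - 1)"
      using 1 q by (intro mult_right_mono) (auto simp: one_le_power)
    also have "\<dots> \<le> 4 * (q * A)" using qA by simp
    finally have "(2 + z) * (1 - q\<^sup>2) / 2 + 2 * q * A \<ge> 0" by (simp add: field_simps)
    then have "(2 - z) * ((2 + z) * (1 - q\<^sup>2) / 2 + 2 * q * A) / r \<ge> 0" using 1 r by simp
    also have "(2 - z) * ((2 + z) * (1 - q\<^sup>2) / 2 + 2 * q * A)
        = r * (4 - z\<^sup>2) / 4 - (q * 2 - A)\<^sup>2 + (q * z - A)\<^sup>2"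
      by (simp add: r_def field_simps power2_eq_square)
    also have "\<dots> / r = (4 - z\<^sup>2) / 4 - (q * 2 - A)\<^sup>2 / r + (q * z - A)\<^sup>2 / r"
      using r by (simp add: add_divide_distrib diff_divide_distrib)
    finally have "G z \<le> G 2"
      unfolding G Omega_inside[OF 1] using Omega_inside[of 2] by (simp add: field_simps)
    also have "\<dots> \<le> G (s + 1 / s)" using out[of 1] by simp
    finally show ?thesis .
  next
    case 2
    then show ?thesis using out joukowski_surj by metis
  next
    case 3
    then obtain w where w: "w \<ge> 1" "- z = w + 1 / w" using joukowski_surj by metis
    then have z: "z = - (w + 1 / w)" by simp
    have "0 \<le> 4 * ((q * (w + 1 / w)) * A)" using w(1) q A0 by simp
    also have "\<dots> = (q * z - A)\<^sup>2 - (q * (w + 1 / w) - A)\<^sup>2"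
      unfolding z by (simp only: power2_eq_square) (simp add: algebra_simps)
    finally have "(q * (w + 1 / w) - A)\<^sup>2 / r \<le> (q * z - A)\<^sup>2 / r"
      using r by (simp add: divide_right_mono)
    then have "G z \<le> G (w + 1 / w)"
      unfolding G unfolding z Omega_joukowski[OF w(1)] by simp
    also have "\<dots> \<le> G (s + 1 / s)" by (rule out[OF w(1)])
    finally show ?thesis .
  qed
qed

text \<open>
  With \<open>q = \<surd>(p - 1)\<close> and \<open>s = u / q\<close>, the rescaling \<open>z = \<surd>(2 p) y / q\<close> turns the quadratic in
  \<open>y\<close> into the penalty of \<open>penalised_Omega_max\<close>.
\<close>

lemma maximal_value:
  fixes p :: nat and t u :: real
  assumes p: "p \<ge> 3" and u: "u \<ge> sqrt (real p - 1)" and ut: "u - 1 / u = sqrt (2 * real p) * t"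
  defines "\<Phi> \<equiv> \<lambda>y. real p * t\<^sup>2 - (y - t)\<^sup>2 + Omega (sqrt (2 * real p / (real p - 1)) * y)"
  shows "\<exists>y. \<Phi> y = u\<^sup>2 / 2 - 1 + ln u - ln (real p - 1) / 2"
    and "\<Phi> y \<le> u\<^sup>2 / 2 - 1 + ln u - ln (real p - 1) / 2"
proof -
  define q where "q = sqrt (real p - 1)"
  define r where "r = sqrt (2 * real p)"
  define s where "s = u / q"
  define G where "G = (\<lambda>z. Omega z - (q * z - (q * s - 1 / (q * s)))\<^sup>2 / (2 * (q\<^sup>2 + 1)))"
  have q1: "q \<ge> 1" using p by (simp add: q_def)
  have q2: "q\<^sup>2 = real p - 1" using p by (simp add: q_def)
  have s1: "s \<ge> 1" using u q1 by (simp add: s_def q_def)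
  have qs: "q * s = u" using q1 by (simp add: s_def)
  have u0: "u > 0" using u q1 unfolding q_def by linarith
  have r0: "r > 0" using p by (simp add: r_def)
  have r2: "r\<^sup>2 = 2 * (q\<^sup>2 + 1)" using p by (simp add: r_def q2)
  have pt: "real p * t\<^sup>2 = (u - 1 / u)\<^sup>2 / 2"
    by (simp add: ut power_mult_distrib)
  have \<Phi>G: "\<Phi> y = (u - 1 / u)\<^sup>2 / 2 + G (r / q * y)" for y
  proof -
    have "q * (r / q * y) - (q * s - 1 / (q * s)) = r * (y - t)"
      using q1 ut unfolding qs by (simp add: r_def algebra_simps)
    then have "(q * (r / q * y) - (q * s - 1 / (q * s)))\<^sup>2 / (2 * (q\<^sup>2 + 1)) = (y - t)\<^sup>2"
      unfolding r2[symmetric] using r0 by (simp add: power_mult_distrib)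
    moreover have "sqrt (2 * real p / (real p - 1)) = r / q"
      by (simp add: r_def q_def real_sqrt_divide)
    ultimately show ?thesis by (simp add: \<Phi>_def G_def pt)
  qed
  have "(u - 1 / u)\<^sup>2 / 2 + (ln s - 1 / (2 * (q * s)\<^sup>2)) = u\<^sup>2 / 2 - 1 + ln s"
    unfolding qs using u0 by (simp add: field_simps power2_eq_square)
  moreover have "ln s = ln u - ln (real p - 1) / 2"
    using u0 q1 p by (simp add: s_def ln_div q_def ln_sqrt)
  ultimately have val: "(u - 1 / u)\<^sup>2 / 2 + G (s + 1 / s) = u\<^sup>2 / 2 - 1 + ln u - ln (real p - 1) / 2"
    using penalised_Omega_max(1)[OF q1 s1] by (simp add: G_def)
  have "\<Phi> (q / r * (s + 1 / s)) = u\<^sup>2 / 2 - 1 + ln u - ln (real p - 1) / 2"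
    using q1 r0 by (simp only: \<Phi>G flip: val) simp
  then show "\<exists>y. \<Phi> y = u\<^sup>2 / 2 - 1 + ln u - ln (real p - 1) / 2" ..
  show "\<Phi> y \<le> u\<^sup>2 / 2 - 1 + ln u - ln (real p - 1) / 2"
    unfolding \<Phi>G val[symmetric] G_def by (intro add_left_mono penalised_Omega_max(2) q1 s1)
qed

lemma GREATEST_range:
  fixes f :: "'a \<Rightarrow> real"
  assumes "f x = M" "\<And>x. f x \<le> M"
  shows "(GREATEST s. s \<in> range f) = M"
  by (rule Greatest_equality) (use assms in auto)

lemma Sigma_tot_eq:
  fixes p k :: nat and lam :: "'r::finite \<Rightarrow> real" and ks :: "'r \<Rightarrow> nat"
  assumes p: "p \<ge> 3" and ks: "\<And>i. ks i = k"
    and u: "u \<ge> sqrt (real p - 1)" and ut: "u - 1 / u = sqrt (2 * real p) * tau p lam k m"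
  shows "2 * Sigma_tot p lam ks m = u\<^sup>2 - 1 + ln (u\<^sup>2) + ln (1 - (norm m)\<^sup>2)
    - 2 * (real k)\<^sup>2 / real p * (\<Sum>i\<in>UNIV. (lam i)\<^sup>2 * (m $ i) ^ (2 * k - 2))"
proof -
  define t where "t = tau p lam k m"
  define \<Phi> where "\<Phi> = (\<lambda>y. real p * t\<^sup>2 - (y - t)\<^sup>2 + Omega (sqrt (2 * real p / (real p - 1)) * y))"
  define M where "M = u\<^sup>2 / 2 - 1 + ln u - ln (real p - 1) / 2"
  \<comment> \<open>\<open>C\<close> collects the terms of \<open>Sigma_y\<close> that do not involve \<open>y\<close> or \<open>t\<close>.\<close>
  define C where "C = 1 / 2 * (ln (real p - 1) + 1) + 1 / 2 * ln (1 - (norm m)\<^sup>2)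
    - (real k)\<^sup>2 / real p * (\<Sum>i\<in>UNIV. (lam i)\<^sup>2 * (m $ i) ^ (2 * k - 2))"
  have p0: "real p > 0" using p by simp
  have T: "(\<Sum>i\<in>UNIV. lam i * real (ks i) * (m $ i) ^ ks i) = real p * t"
    using p0 by (simp add: t_def tau_def ks sum_distrib_left mult_ac)
  have S: "1 / real p * (\<Sum>i\<in>UNIV. (lam i)\<^sup>2 * (real (ks i))\<^sup>2 * (m $ i) ^ (2 * ks i - 2))
      = (real k)\<^sup>2 / real p * (\<Sum>i\<in>UNIV. (lam i)\<^sup>2 * (m $ i) ^ (2 * k - 2))"
    by (simp add: ks sum_distrib_left mult_ac)
  have Sy: "Sigma_y p lam ks m y = C + \<Phi> y" for y
    unfolding Sigma_y_def T S C_def \<Phi>_def using p0 by (simp add: power2_eq_square)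
  obtain y0 where y0: "\<Phi> y0 = M"
    using maximal_value(1)[OF p u ut] unfolding \<Phi>_def M_def t_def by blast
  have le: "\<Phi> y \<le> M" for y
    using maximal_value(2)[OF p u ut] unfolding \<Phi>_def M_def t_def by blast
  define x0 where "x0 = y0 + (\<Sum>i\<in>UNIV. lam i * (1 - real (ks i) / real p) * (m $ i) ^ ks i)"
  have "Sigma_tot p lam ks m = C + M"
    unfolding Sigma_tot_def
  proof (rule GREATEST_range)
    show "Sigma_tot_x p lam ks m x0 = C + M"
      by (simp add: Sigma_tot_x_def Sy y_of_def x0_def y0)
    show "Sigma_tot_x p lam ks m x \<le> C + M" for x
      by (simp add: Sigma_tot_x_def Sy le)
  qed
  moreover have "sqrt (real p - 1) > 0" using p by simp
  then have "u > 0" using u by linarith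
  then have "ln (u\<^sup>2) = 2 * ln u" by (simp add: ln_realpow)
  ultimately show ?thesis by (simp add: C_def M_def field_simps)
qed

text \<open>
  The map \<open>u \<mapsto> u - 1 / u\<close> increases from its value at \<open>\<surd>(p - 1)\<close>, which is \<open>\<surd>(2 p) tau_c\<close>; so
  \<open>tau_c\<close> marks the point where the maximiser leaves the bulk.
\<close>

lemma tau_parameter:
  fixes p :: nat
  assumes p: "p \<ge> 3" and t: "t \<ge> tau_c p"
  obtains u where "u \<ge> sqrt (real p - 1)" "u - 1 / u = sqrt (2 * real p) * t"
proof -
  define b where "b = sqrt (2 * real p) * t"
  define q where "q = sqrt (real p - 1)"
  have p1: "real p - 1 > 0" using p by simp
  have q: "q > 0" "q\<^sup>2 = real p - 1" using p1 by (auto simp: q_def)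
  \<comment> \<open>The positive root of \<open>u\<^sup>2 - b u - 1 = 0\<close>.\<close>
  define u where "u = (b + sqrt (b\<^sup>2 + 4)) / 2"
  have "sqrt (b\<^sup>2 + 4) > \<bar>b\<bar>" by (rule real_less_rsqrt) simp
  then have u0: "u > 0" by (simp add: u_def)
  have "u\<^sup>2 = b * u + 1" by (simp add: u_def power2_eq_square field_simps)
  then have ub: "u - 1 / u = b" using u0 by (simp add: field_simps power2_eq_square)
  have "b \<ge> sqrt (2 * real p) * tau_c p" unfolding b_def using t by (intro mult_left_mono) auto
  also have "sqrt (2 * real p) * tau_c p = (real p - 2) / q"
    using p by (simp add: tau_c_def q_def real_sqrt_mult)
  also have "\<dots> = q - 1 / q" using q by (simp add: field_simps power2_eq_square)
  finally have bq: "q - 1 / q \<le> u - 1 / u" using ub by simp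
  have "q \<le> u"
  proof (rule ccontr)
    assume "\<not> q \<le> u"
    then have "u < q" "1 / q < 1 / u" using u0 q by (auto simp: divide_strict_left_mono)
    then show False using bq by linarith
  qed
  then show ?thesis using that ub by (simp add: q_def b_def)
qed

section \<open>Nonpositivity and the equality case\<close>

text \<open>
  With \<open>ln x \<le> x - 1\<close> the left-hand side is at most \<open>- (v (1 - \<rho>) - 1)\<^sup>2 / (v \<rho>)\<close>.
\<close>

lemma log_free_energy_bound:
  fixes v \<rho> :: real
  assumes "v > 0" "0 < \<rho>" "\<rho> < 1"
  shows "v - 1 + ln (v * (1 - \<rho>)) - (v - 1)\<^sup>2 / (v * \<rho>) \<le> 0"
    and "v - 1 + ln (v * (1 - \<rho>)) - (v - 1)\<^sup>2 / (v * \<rho>) = 0 \<longleftrightarrow> v * (1 - \<rho>) = 1"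
proof -
  have vr: "v * \<rho> > 0" and x: "v * (1 - \<rho>) > 0" using assms by auto
  have sq: "v - 1 + (v * (1 - \<rho>) - 1) - (v - 1)\<^sup>2 / (v * \<rho>) = - (v * (1 - \<rho>) - 1)\<^sup>2 / (v * \<rho>)"
    using assms by (simp add: field_simps power2_eq_square)
  have le: "ln (v * (1 - \<rho>)) \<le> v * (1 - \<rho>) - 1" by (rule ln_le_minus_one[OF x])
  have neg: "- (v * (1 - \<rho>) - 1)\<^sup>2 / (v * \<rho>) \<le> 0" using vr by simp
  show "v - 1 + ln (v * (1 - \<rho>)) - (v - 1)\<^sup>2 / (v * \<rho>) \<le> 0"
    using sq le neg by linarith
  show "v - 1 + ln (v * (1 - \<rho>)) - (v - 1)\<^sup>2 / (v * \<rho>) = 0 \<longleftrightarrow> v * (1 - \<rho>) = 1"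
  proof
    assume "v - 1 + ln (v * (1 - \<rho>)) - (v - 1)\<^sup>2 / (v * \<rho>) = 0"
    then have "ln (v * (1 - \<rho>)) = v * (1 - \<rho>) - 1" using sq le neg by linarith
    then show "v * (1 - \<rho>) = 1" using ln_eq_minus_one x by blast
  next
    assume a: "v * (1 - \<rho>) = 1"
    then show "v - 1 + ln (v * (1 - \<rho>)) - (v - 1)\<^sup>2 / (v * \<rho>) = 0"
      using sq by simp
  qed
qed

text \<open>
  Cauchy-Schwarz for the vectors \<open>lam i * x i ^ (k - 1)\<close> and \<open>x i\<close>. The defect times
  \<open>\<Sum>i. (x i)\<^sup>2\<close> is a sum of squares, which gives the inequality and the equality case at once.
\<close>

lemma weighted_power_sums:
  fixes lam x :: "'i::finite \<Rightarrow> real"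
  assumes k: "k \<ge> 2"
  shows "(\<Sum>i\<in>UNIV. lam i * x i ^ k)\<^sup>2 \<le> (\<Sum>i\<in>UNIV. (lam i)\<^sup>2 * x i ^ (2 * k - 2)) * (\<Sum>i\<in>UNIV. (x i)\<^sup>2)"
    and "(\<exists>i. x i \<noteq> 0) \<Longrightarrow>
      (\<Sum>i\<in>UNIV. lam i * x i ^ k)\<^sup>2 = (\<Sum>i\<in>UNIV. (lam i)\<^sup>2 * x i ^ (2 * k - 2)) * (\<Sum>i\<in>UNIV. (x i)\<^sup>2)
      \<longleftrightarrow> (\<forall>i j. x i \<noteq> 0 \<and> x j \<noteq> 0 \<longrightarrow> lam i * x i ^ (k - 2) = lam j * x j ^ (k - 2))"
proof -
  define B where "B = (\<Sum>i\<in>UNIV. lam i * x i ^ k)"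
  define A where "A = (\<Sum>i\<in>UNIV. (lam i)\<^sup>2 * x i ^ (2 * k - 2))"
  define R where "R = (\<Sum>i\<in>UNIV. (x i)\<^sup>2)"
  define c where "c = (\<lambda>i. lam i * x i ^ (k - 2))"
  obtain n where n: "k = n + 2" using k by (metis le_add_diff_inverse2)
  have B: "B = (\<Sum>i\<in>UNIV. c i * (x i)\<^sup>2)"
    unfolding B_def c_def n by (simp add: power_add power2_eq_square mult_ac)
  have A: "A = (\<Sum>i\<in>UNIV. (c i)\<^sup>2 * (x i)\<^sup>2)"
  proof -
    have "x i ^ (2 * k - 2) = (x i ^ n)\<^sup>2 * (x i)\<^sup>2" for i
    proof -
      have "2 * k - 2 = n * 2 + 2" using n by simp
      then show ?thesis by (simp only: power_add power_mult)
    qed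
    then show ?thesis unfolding A_def c_def n by (simp add: power_mult_distrib mult.assoc)
  qed
  have R0: "R \<ge> 0" unfolding R_def by (intro sum_nonneg) auto
  have key: "R * (A * R - B\<^sup>2) = (\<Sum>i\<in>UNIV. ((c i * R - B) * x i)\<^sup>2)"
  proof -
    have "((c i * R - B) * x i)\<^sup>2 = R\<^sup>2 * ((c i)\<^sup>2 * (x i)\<^sup>2) - 2 * B * R * (c i * (x i)\<^sup>2) + B\<^sup>2 * (x i)\<^sup>2" for i
      by (simp add: power2_eq_square algebra_simps)
    then have "(\<Sum>i\<in>UNIV. ((c i * R - B) * x i)\<^sup>2) = R\<^sup>2 * A - 2 * B * R * B + B\<^sup>2 * R"
      by (simp add: sum.distrib sum_subtractf A B R_def flip: sum_distrib_left)
    then show ?thesis by (simp add: power2_eq_square algebra_simps)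
  qed
  have Rz: "R = 0 \<longleftrightarrow> (\<forall>i. x i = 0)"
    unfolding R_def by (subst sum_nonneg_eq_0_iff) auto
  show "B\<^sup>2 \<le> A * R"
  proof (cases "R = 0")
    case True
    then have "\<forall>i. x i = 0" using Rz by simp
    then show ?thesis unfolding A B True by simp
  next
    case False
    have "0 \<le> R * (A * R - B\<^sup>2)" unfolding key by (intro sum_nonneg) auto
    then show ?thesis using False R0 by (simp add: zero_le_mult_iff)
  qed
  assume ex: "\<exists>i. x i \<noteq> 0"
  then have Rp: "R > 0" using Rz R0 by fastforce
  have "B\<^sup>2 = A * R \<longleftrightarrow> R * (A * R - B\<^sup>2) = 0" using Rp by auto
  also have "\<dots> \<longleftrightarrow> (\<forall>i. x i \<noteq> 0 \<longrightarrow> c i * R = B)"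
    unfolding key by (subst sum_nonneg_eq_0_iff) auto
  also have "\<dots> \<longleftrightarrow> (\<forall>i j. x i \<noteq> 0 \<and> x j \<noteq> 0 \<longrightarrow> c i = c j)"
  proof (intro iffI allI impI)
    fix i j assume "\<forall>i. x i \<noteq> 0 \<longrightarrow> c i * R = B" "x i \<noteq> 0 \<and> x j \<noteq> 0"
    then have "c i * R = c j * R" by simp
    then show "c i = c j" using Rp by simp
  next
    fix i assume a: "\<forall>i j. x i \<noteq> 0 \<and> x j \<noteq> 0 \<longrightarrow> c i = c j" and i: "x i \<noteq> 0"
    have "c i * (x j)\<^sup>2 = c j * (x j)\<^sup>2" for j
      using i by (cases "x j = 0") (simp, metis a)
    then show "c i * R = B" unfolding B R_def sum_distrib_left by (rule sum.cong[OF refl])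
  qed
  finally show "B\<^sup>2 = A * R \<longleftrightarrow> (\<forall>i j. x i \<noteq> 0 \<and> x j \<noteq> 0 \<longrightarrow> lam i * x i ^ (k - 2) = lam j * x j ^ (k - 2))"
    unfolding c_def .
qed

lemma norm_sq_eq_sum: "(norm (m :: real ^ 'r))\<^sup>2 = (\<Sum>i\<in>UNIV. (m $ i)\<^sup>2)"
  unfolding power2_norm_eq_inner by (simp add: inner_vec_def power2_eq_square)

lemma diff_inverse_inj:
  fixes a b :: real
  assumes "a > 0" "b > 0" "a - 1 / a = b - 1 / b"
  shows "a = b"
proof -
  have "(a - b) * (1 + 1 / (a * b)) = 0" using assms by (simp add: field_simps)
  moreover have "1 + 1 / (a * b) > 0" using assms by (simp add: add_pos_pos)
  ultimately show ?thesis by simp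
qed

text \<open>
  Twice the value is a difference \<open>F - E\<close>, where \<open>F \<le> 0\<close> is the expression of
  \<open>log_free_energy_bound\<close> and \<open>E \<ge> 0\<close> is a multiple of the Cauchy-Schwarz defect. The third claim
  comes from the bound \<open>u \<ge> \<surd>(p - 1)\<close> on the parameter of \<open>Sigma_tot_eq\<close>: equality forces \<open>u\<^sup>2 (1 - \<rho>) = 1\<close>.
\<close>

lemma Sigma_tot_nonpos:
  fixes p k :: nat and lam :: "'r::finite \<Rightarrow> real" and ks :: "'r \<Rightarrow> nat"
  assumes p: "p \<ge> 3" and k: "k \<ge> 3" and ks: "\<And>i. ks i = k"
    and m: "m \<in> D_set" and t: "tau p lam k m \<ge> tau_c p"
  defines "\<rho> \<equiv> (norm m)\<^sup>2"
  defines "balanced \<equiv> \<forall>i j. m $ i \<noteq> 0 \<and> m $ j \<noteq> 0 \<longrightarrow> lam i * (m $ i) ^ (k - 2) = lam j * (m $ j) ^ (k - 2)"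
  shows "Sigma_tot p lam ks m \<le> 0"
    and "Sigma_tot p lam ks m = 0 \<longleftrightarrow> balanced \<and> tau p lam k m = 1 / sqrt (2 * real p) * (\<rho> / sqrt (1 - \<rho>))"
    and "Sigma_tot p lam ks m = 0 \<Longrightarrow> (real p - 2) / (real p - 1) \<le> \<rho>"
    and "0 < \<rho>" and "\<rho> < 1"
proof -
  define T where "T = tau p lam k m"
  obtain u where u: "u \<ge> sqrt (real p - 1)" and ut: "u - 1 / u = sqrt (2 * real p) * T"
    using tau_parameter[OF p t] unfolding T_def .
  define v where "v = u\<^sup>2"
  define A where "A = (\<Sum>i\<in>UNIV. (lam i)\<^sup>2 * (m $ i) ^ (2 * k - 2))"
  define B where "B = (\<Sum>i\<in>UNIV. lam i * (m $ i) ^ k)"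
  have p0: "real p > 0" "real p - 1 > 0" using p by auto
  have k0: "real k > 0" using k by simp
  have "sqrt (real p - 1) > 0" using p0 by simp
  then have u0: "u > 0" using u by linarith
  then have v0: "v > 0" by (simp add: v_def)
  have vp: "v \<ge> real p - 1"
    using power_mono[OF u, of 2] p0 by (simp add: v_def)
  have "norm m < 1" using m by (simp add: D_set_def)
  then show r1: "\<rho> < 1" unfolding \<rho>_def by (simp add: power_less_one_iff abs_square_less_1)
  have BT: "B = real p * T / real k"
    using p0 k0 by (simp add: T_def tau_def B_def)
  have "tau_c p > 0" unfolding tau_c_def using p by simp
  then have T0: "T > 0" using t by (simp add: T_def)
  have ex: "\<exists>i. m $ i \<noteq> 0"
  proof (rule ccontr)
    assume "\<not> ?thesis"
    then have "B = 0" using k by (simp add: B_def power_0_left)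
    then show False using BT T0 p0 k0 by simp
  qed
  have rsum: "\<rho> = (\<Sum>i\<in>UNIV. (m $ i)\<^sup>2)" by (simp add: \<rho>_def norm_sq_eq_sum)
  show r0: "0 < \<rho>" using ex unfolding \<rho>_def by (auto simp: vec_eq_iff)
  have CS: "B\<^sup>2 \<le> A * \<rho>" and CS_eq: "B\<^sup>2 = A * \<rho> \<longleftrightarrow> balanced"
    unfolding A_def B_def rsum balanced_def
    using weighted_power_sums[where lam = lam and x = "\<lambda>i. m $ i"] k ex by auto
  define F where "F = v - 1 + ln (v * (1 - \<rho>)) - (v - 1)\<^sup>2 / (v * \<rho>)"
  define E where "E = 2 * (real k)\<^sup>2 / (real p * \<rho>) * (A * \<rho> - B\<^sup>2)"
  have F: "F \<le> 0" "F = 0 \<longleftrightarrow> v * (1 - \<rho>) = 1"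
    unfolding F_def using log_free_energy_bound[OF v0 r0 r1] by auto
  have E: "E \<ge> 0" "E = 0 \<longleftrightarrow> B\<^sup>2 = A * \<rho>"
    unfolding E_def using CS p0 k0 r0 by auto
  have "2 * Sigma_tot p lam ks m = v - 1 + (ln v + ln (1 - \<rho>)) - 2 * (real k)\<^sup>2 / real p * A"
    using Sigma_tot_eq[OF p ks u ut[unfolded T_def]] by (simp add: v_def \<rho>_def A_def)
  also have "ln v + ln (1 - \<rho>) = ln (v * (1 - \<rho>))" using v0 r1 by (simp add: ln_mult)
  also have "2 * (real k)\<^sup>2 / real p * A = E + (v - 1)\<^sup>2 / (v * \<rho>)"
  proof -
    have "(v - 1)\<^sup>2 / v = (u - 1 / u)\<^sup>2"
      using u0 by (simp add: v_def field_simps power2_eq_square)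
    also have "\<dots> = 2 * real p * T\<^sup>2" using p0 by (simp add: ut power_mult_distrib)
    also have "\<dots> = 2 * (real k)\<^sup>2 / real p * B\<^sup>2"
      using p0 k0 by (simp add: BT power2_eq_square)
    finally have "(v - 1)\<^sup>2 / v / \<rho> = 2 * (real k)\<^sup>2 / real p * B\<^sup>2 / \<rho>" by simp
    then show ?thesis using r0 p0 by (simp add: E_def field_simps)
  qed
  finally have S: "2 * Sigma_tot p lam ks m = F - E" by (simp add: F_def)
  show "Sigma_tot p lam ks m \<le> 0" using S F(1) E(1) by linarith
  have zero: "Sigma_tot p lam ks m = 0 \<longleftrightarrow> v * (1 - \<rho>) = 1 \<and> balanced"
  proof -
    have "Sigma_tot p lam ks m = 0 \<longleftrightarrow> F = 0 \<and> E = 0" using S F(1) E(1) by linarith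
    then show ?thesis by (simp only: F(2) E(2) CS_eq)
  qed
  define \<sigma> where "\<sigma> = sqrt (1 - \<rho>)"
  have s0: "\<sigma> > 0" and s2: "\<sigma>\<^sup>2 = 1 - \<rho>" using r1 by (auto simp: \<sigma>_def)
  have "v * (1 - \<rho>) = 1 \<longleftrightarrow> (u * \<sigma>)\<^sup>2 = 1" by (simp add: v_def s2 power_mult_distrib)
  also have "\<dots> \<longleftrightarrow> u = 1 / \<sigma>"
  proof -
    have "u * \<sigma> > 0" using u0 s0 by simp
    then have "(u * \<sigma>)\<^sup>2 = 1 \<longleftrightarrow> u * \<sigma> = 1" by (auto simp only: power2_eq_1_iff)
    then show ?thesis using s0 by (simp add: eq_divide_eq)
  qed
  also have "\<dots> \<longleftrightarrow> u - 1 / u = 1 / \<sigma> - 1 / (1 / \<sigma>)"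
    using diff_inverse_inj[OF u0, of "1 / \<sigma>"] s0 by auto
  also have "1 / \<sigma> - 1 / (1 / \<sigma>) = \<rho> / \<sigma>"
    using s0 s2 by (simp add: field_simps power2_eq_square)
  also have "u - 1 / u = \<rho> / \<sigma> \<longleftrightarrow> T = 1 / sqrt (2 * real p) * (\<rho> / \<sigma>)"
  proof -
    have "c * T = x \<longleftrightarrow> T = 1 / c * x" if "c > 0" for c x :: real
      using that by (simp add: eq_divide_eq mult.commute)
    moreover have "sqrt (2 * real p) > 0" using p0 by simp
    ultimately show ?thesis unfolding ut by blast
  qed
  finally show "Sigma_tot p lam ks m = 0 \<longleftrightarrow>
      balanced \<and> tau p lam k m = 1 / sqrt (2 * real p) * (\<rho> / sqrt (1 - \<rho>))"
    unfolding zero by (auto simp: T_def \<sigma>_def)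
  assume "Sigma_tot p lam ks m = 0"
  then have "v * (1 - \<rho>) = 1" by (simp add: zero)
  then have "(real p - 1) * (1 - \<rho>) \<le> 1" using vp r1 by (metis diff_ge_0_iff_ge less_imp_le mult_right_mono)
  then show "(real p - 2) / (real p - 1) \<le> \<rho>" using p0 by (simp add: field_simps)
qed

section \<open>The threshold for eta\<close>

text \<open>
  The function \<open>x ^ n * (1 - x)\<close> increases on \<open>[0, n / (n + 1)]\<close> and decreases afterwards. Which
  of the two bounds is the relevant one accounts for the two branches of \<open>eta_c\<close>.
\<close>

lemma power_mult_one_minus_bounds:
  fixes \<rho> :: real
  assumes n: "n \<ge> 1" and r: "0 \<le> \<rho>" "\<rho> \<le> 1"
  shows "\<rho> ^ n * (1 - \<rho>) \<le> real n ^ n / (real n + 1) ^ (n + 1)"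
    and "real n / (real n + 1) \<le> a \<Longrightarrow> a \<le> \<rho> \<Longrightarrow> \<rho> ^ n * (1 - \<rho>) \<le> a ^ n * (1 - a)"
proof -
  define g where "g = (\<lambda>x::real. x ^ n * (1 - x))"
  define b where "b = real n / (real n + 1)"
  have d: "(g has_real_derivative (x ^ (n - 1) * (real n - (real n + 1) * x))) (at x)" for x
  proof -
    have "x ^ n = x ^ (n - 1) * x" using n by (metis power_minus_mult less_le_trans zero_less_one)
    then show ?thesis
      unfolding g_def by (auto intro!: derivative_eq_intros simp: algebra_simps)
  qed
  have b: "0 \<le> b" "b \<le> 1" by (auto simp: b_def)
  have up: "g x \<le> g y" if "0 \<le> x" "x \<le> y" "y \<le> b" for x y
  proof (rule DERIV_nonneg_imp_nondecreasing[OF that(2)])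
    fix z assume z: "x \<le> z" "z \<le> y"
    then have "z \<le> b" using that by simp
    then have "(real n + 1) * z \<le> real n" by (simp add: b_def field_simps)
    then show "\<exists>d. (g has_real_derivative d) (at z) \<and> 0 \<le> d"
      using d[of z] z that by (intro exI[of _ "z ^ (n - 1) * (real n - (real n + 1) * z)"]) auto
  qed
  have down: "g y \<le> g x" if "b \<le> x" "x \<le> y" for x y
  proof (rule DERIV_nonpos_imp_nonincreasing[OF that(2)])
    fix z assume z: "x \<le> z" "z \<le> y"
    then have zb: "b \<le> z" using that by simp
    then have "real n \<le> (real n + 1) * z" by (simp add: b_def field_simps)
    then show "\<exists>d. (g has_real_derivative d) (at z) \<and> d \<le> 0"
      using d[of z] zb b
      by (intro exI[of _ "z ^ (n - 1) * (real n - (real n + 1) * z)"]) (auto intro!: mult_nonneg_nonpos)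
  qed
  have "g \<rho> \<le> g b" using up[of \<rho> b] down[of b \<rho>] r by linarith
  also have "g b = real n ^ n / (real n + 1) ^ (n + 1)"
  proof -
    have "1 - b = 1 / (real n + 1)" by (simp add: b_def field_simps)
    then show ?thesis unfolding g_def by (simp add: b_def power_divide)
  qed
  finally show "\<rho> ^ n * (1 - \<rho>) \<le> real n ^ n / (real n + 1) ^ (n + 1)" by (simp add: g_def)
  assume "real n / (real n + 1) \<le> a" "a \<le> \<rho>"
  then show "\<rho> ^ n * (1 - \<rho>) \<le> a ^ n * (1 - a)" using down[of a \<rho>] by (simp add: g_def b_def)
qed

lemma mult_powr_inverse_nat:
  fixes x y :: real
  assumes "x > 0" "y \<ge> 0" "n > 0"
  shows "x * y powr (1 / real n) = (x ^ n * y) powr (1 / real n)"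
proof -
  have "(x ^ n) powr (1 / real n) = x"
    using assms by (simp add: powr_powr flip: powr_realpow)
  then show ?thesis using assms by (simp add: powr_mult)
qed

text \<open>
  If \<open>lam i * (m $ i) ^ (k - 2) = a\<close>, then \<open>lam i powr (- 2 / (k - 2))\<close> is \<open>(m $ i)\<^sup>2\<close> times a
  power of \<open>a\<close>, so \<open>eta\<close> is a multiple of \<open>\<parallel>m\<parallel>\<^sup>2\<close>.
\<close>

lemma eta_eq_balanced:
  fixes lam :: "'r::finite \<Rightarrow> real"
  assumes k: "k \<ge> 3" and a: "a > 0" and m: "\<And>i. m $ i \<ge> 0"
    and bal: "\<And>i. m $ i \<noteq> 0 \<Longrightarrow> lam i * (m $ i) ^ (k - 2) = a"
  shows "eta lam k m = (norm m)\<^sup>2 * (1 / a\<^sup>2) powr (1 / real (k - 2))"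
proof -
  define n where "n = k - 2"
  have n: "n > 0" "real k - 2 = real n" using k by (auto simp: n_def)
  have "lam i powr (- 2 / real n) * (if m $ i \<noteq> 0 then 1 else 0) = (m $ i)\<^sup>2 * (1 / a\<^sup>2) powr (1 / real n)" for i
  proof (cases "m $ i = 0")
    case False
    then have x: "m $ i > 0" using m[of i] by simp
    have l: "lam i = a * (m $ i) powr (- real n)"
      using bal[OF False] x by (simp add: n_def powr_minus powr_realpow field_simps)
    have "lam i powr (- 2 / real n) = a powr (- 2 / real n) * (m $ i) powr 2"
      unfolding l using a x n by (simp add: powr_mult powr_powr)
    also have "a powr (- 2 / real n) = (a powr (-2)) powr (1 / real n)"
      by (simp add: powr_powr)
    also have "a powr (-2) = 1 / a\<^sup>2" using a by (simp add: powr_minus field_simps)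
    finally show ?thesis using False x by simp
  qed simp
  then show ?thesis
    unfolding eta_def n(2) norm_sq_eq_sum by (simp add: sum_distrib_right n_def)
qed

text \<open>
  The relation for \<open>tau\<close> fixes the common value \<open>a\<close> of the balanced products by
  \<open>1 / a\<^sup>2 = (2 k\<^sup>2 / p) (1 - \<rho>)\<close>, so \<open>eta\<close> becomes a function of \<open>\<rho>\<close> alone, to be maximised over
  \<open>\<rho> \<ge> (p - 2) / (p - 1)\<close>. For \<open>k \<ge> p\<close> the free maximum at \<open>(k - 2) / (k - 1)\<close> satisfies this
  constraint; for \<open>k < p\<close> the maximum is at the boundary.
\<close>

lemma eta_le_eta_c:
  fixes lam :: "'r::finite \<Rightarrow> real"
  assumes p: "p \<ge> 3" and lam: "\<And>i. lam i > 0" and k: "k \<ge> 3" and m: "\<And>i. m $ i \<ge> 0"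
    and bal: "\<And>i j. m $ i \<noteq> 0 \<Longrightarrow> m $ j \<noteq> 0 \<Longrightarrow> lam i * (m $ i) ^ (k - 2) = lam j * (m $ j) ^ (k - 2)"
  defines "\<rho> \<equiv> (norm m)\<^sup>2"
  assumes r: "0 < \<rho>" "\<rho> < 1" "(real p - 2) / (real p - 1) \<le> \<rho>"
    and T: "tau p lam k m = 1 / sqrt (2 * real p) * (\<rho> / sqrt (1 - \<rho>))"
  shows "eta lam k m \<le> eta_c p k"
proof -
  define n where "n = k - 2"
  have n: "n > 0" "k = n + 2" "real k - 2 = real n" using k by (auto simp: n_def)
  have p0: "real p > 0" using p by simp
  obtain i0 where i0: "m $ i0 \<noteq> 0" using r(1) unfolding \<rho>_def by (auto simp: vec_eq_iff)
  define a where "a = lam i0 * (m $ i0) ^ (k - 2)"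
  have a0: "a > 0" unfolding a_def using lam[of i0] m[of i0] i0 by (simp add: less_le)
  have ba: "lam i * (m $ i) ^ (k - 2) = a" if "m $ i \<noteq> 0" for i
    unfolding a_def by (rule bal[OF that i0])
  have summand: "lam i * (m $ i) ^ k = a * (m $ i)\<^sup>2" for i
  proof (cases "m $ i = 0")
    case False
    have "lam i * (m $ i) ^ k = (lam i * (m $ i) ^ (k - 2)) * (m $ i)\<^sup>2"
    proof -
      have "(k - 2) + 2 = k" using k by simp
      then have "(m $ i) ^ k = (m $ i) ^ (k - 2) * (m $ i)\<^sup>2" by (metis power_add)
      then show ?thesis by (simp only: mult.assoc)
    qed
    then show ?thesis by (simp only: ba[OF False])
  qed (use k in simp)
  have "tau p lam k m = real k / real p * (a * \<rho>)"
    unfolding tau_def summand \<rho>_def norm_sq_eq_sum by (simp add: sum_distrib_left)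
  then have "real k / real p * a = 1 / (sqrt (2 * real p) * sqrt (1 - \<rho>))"
  proof -
    have "(real k / real p * a) * \<rho> = 1 / (sqrt (2 * real p) * sqrt (1 - \<rho>)) * \<rho>"
      using T \<open>tau p lam k m = real k / real p * (a * \<rho>)\<close> by simp
    then show ?thesis by (rule mult_right_cancel[THEN iffD1, rotated]) (use r(1) in simp)
  qed
  then have "(real k / real p * a)\<^sup>2 = 1 / (2 * real p * (1 - \<rho>))"
    using r(2) p0 by (simp only: power_divide power_mult_distrib) simp
  then have a2: "1 / a\<^sup>2 = 2 * (real k)\<^sup>2 / real p * (1 - \<rho>)"
  proof -
    have "1 / a\<^sup>2 = (real k / real p)\<^sup>2 * (1 / (real k / real p * a)\<^sup>2)"
      using p0 k by (simp add: power_mult_distrib power_divide)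
    also have "1 / (real k / real p * a)\<^sup>2 = 2 * real p * (1 - \<rho>)"
      using \<open>(real k / real p * a)\<^sup>2 = 1 / (2 * real p * (1 - \<rho>))\<close> by simp
    also have "(real k / real p)\<^sup>2 * \<dots> = 2 * (real k)\<^sup>2 / real p * (1 - \<rho>)"
      using p0 by (simp add: power2_eq_square)
    finally show ?thesis .
  qed
  define N where "N = (if k \<ge> p then real k - 2 else real p - 2)"
  have N0: "N > 0" using p k by (auto simp: N_def)
  have bound: "\<rho> ^ n * (1 - \<rho>) \<le> N ^ n / (N + 1) ^ (n + 1)"
  proof (cases "k \<ge> p")
    case True
    then show ?thesis
      using power_mult_one_minus_bounds(1)[of n \<rho>] n r by (simp add: N_def)
  next
    case False
    have "real n / (real n + 1) \<le> (real p - 2) / (real p - 1)"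
      using False n p by (simp add: field_simps)
    then have "\<rho> ^ n * (1 - \<rho>) \<le> ((real p - 2) / (real p - 1)) ^ n * (1 - (real p - 2) / (real p - 1))"
      using power_mult_one_minus_bounds(2)[of n \<rho>] n r by simp
    also have "1 - (real p - 2) / (real p - 1) = 1 / (real p - 1)"
      using p by (simp add: field_simps)
    finally show ?thesis using False by (simp add: N_def power_divide mult.commute)
  qed
  have "eta lam k m = \<rho> * (2 * (real k)\<^sup>2 / real p * (1 - \<rho>)) powr (1 / real n)"
    using eta_eq_balanced[OF k a0 m ba] by (simp add: a2 \<rho>_def n_def)
  also have "\<dots> = (\<rho> ^ n * (2 * (real k)\<^sup>2 / real p * (1 - \<rho>))) powr (1 / real n)"
    using r n p0 by (intro mult_powr_inverse_nat) auto
  also have "\<dots> \<le> (N ^ n * (2 * (real k)\<^sup>2 / (real p * (N + 1) ^ (n + 1)))) powr (1 / real n)"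
  proof (rule powr_mono2)
    have "2 * (real k)\<^sup>2 / real p * (\<rho> ^ n * (1 - \<rho>)) \<le> 2 * (real k)\<^sup>2 / real p * (N ^ n / (N + 1) ^ (n + 1))"
      using bound p0 by (intro mult_left_mono) auto
    then show "\<rho> ^ n * (2 * (real k)\<^sup>2 / real p * (1 - \<rho>)) \<le> N ^ n * (2 * (real k)\<^sup>2 / (real p * (N + 1) ^ (n + 1)))"
      by (simp add: mult_ac)
  qed (use r p0 in auto)
  also have "\<dots> = N * (2 * (real k)\<^sup>2 / (real p * (N + 1) ^ (n + 1))) powr (1 / real n)"
    using N0 n p0 by (intro mult_powr_inverse_nat[symmetric]) auto
  also have "\<dots> = eta_c p k"
  proof -
    have "n + 1 = k - 1" using k by (simp add: n_def)
    moreover have "N + 1 = (if k \<ge> p then real k - 1 else real p - 1)" by (simp add: N_def)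
    ultimately show ?thesis by (simp only: eta_c_def N_def n(3)) simp
  qed
  finally show ?thesis .
qed

theorem theorem2p9:
  fixes p k :: nat and lam :: "'r::finite \<Rightarrow> real" and ks :: "'r \<Rightarrow> nat"
  assumes "p \<ge> 3"
    and "\<And>i. lam i > 0"
    and "k \<ge> 3"
    and "\<And>i. ks i = k"
  shows "(\<forall>m \<in> D_plus. tau p lam k m \<ge> tau_c p \<longrightarrow> Sigma_tot p lam ks m \<le> 0) \<and>
    (\<forall>m \<in> D_plus. tau p lam k m \<ge> tau_c p \<longrightarrow>
       (eta lam k m > eta_c p k \<longrightarrow> Sigma_tot p lam ks m < 0) \<and>
       (eta lam k m \<le> eta_c p k \<longrightarrow>
          Sigma_tot p lam ks m \<le> 0 \<and>
          (Sigma_tot p lam ks m = 0 \<longleftrightarrow>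
             (\<forall>i j. m $ i \<noteq> 0 \<and> m $ j \<noteq> 0 \<longrightarrow>
                lam i * (m $ i) ^ (k - 2) = lam j * (m $ j) ^ (k - 2)) \<and>
             tau p lam k m = 1 / sqrt (2 * real p) * ((norm m)\<^sup>2 / sqrt (1 - (norm m)\<^sup>2)))))"
proof -
  have D: "m \<in> D_set" if "m \<in> D_plus" for m :: "real ^ 'r"
    using that by (simp add: D_plus_def)
  note nonpos = Sigma_tot_nonpos[where ks = ks, OF assms(1,3,4) D]
  have strict: "Sigma_tot p lam ks m < 0"
    if m: "m \<in> D_plus" and t: "tau p lam k m \<ge> tau_c p" and eta: "eta lam k m > eta_c p k" for m
  proof (rule ccontr)
    note S = nonpos[OF m t]
    assume "\<not> Sigma_tot p lam ks m < 0"
    then have z: "Sigma_tot p lam ks m = 0" using S(1) by simp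
    have m0: "m $ i \<ge> 0" for i using m by (auto simp: D_plus_def)
    note eq = S(2)[THEN iffD1, OF z]
    have "eta lam k m \<le> eta_c p k"
    proof (rule eta_le_eta_c[OF assms(1-3) m0 _ S(4,5) S(3)[OF z] conjunct2[OF eq]])
      fix i j assume "m $ i \<noteq> 0" "m $ j \<noteq> 0"
      then show "lam i * (m $ i) ^ (k - 2) = lam j * (m $ j) ^ (k - 2)"
        using conjunct1[OF eq] by blast
    qed
    then show False using eta by simp
  qed
  show ?thesis
    by (intro conjI ballI impI strict nonpos(1,2))
qed

end
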